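(* Let $n\ge 2$, let $a_1,\dots,a_n$ be real numbers, not all zero, and let $x_1,\dots,x_n$ be real numbers with $x_1+x_2+\cdots+x_n=0$. Then $$\frac{1}{n!}\sum_{\sigma}\max_{1\le k\le n}\left|\sum_{i=1}^k a_i x_{\sigma(i)}\right|^2\le\frac{16}{n-1}\{1+2V_n(a)\}\sum_{i=1}^n a_i^2\sum_{i=1}^n x_i^2,$$ where the sum on the left is taken over all permutations $\sigma$ of $\{1,\dots,n\}$.
   Context: For $a=(a_1,\dots,a_n)$ a real vector that is not zero, define $$V_n(a)=\frac{\max_{1\le k\le n-1}(a_1+a_2+\cdots+a_k)^2}{a_1^2+a_2^2+\cdots+a_n^2}.$$ The $a_i$ and the $x_i$ need not be distinct. *)

theory Defs
  imports Complex_Main "HOL-Combinatorics.Permutations"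
begin

(* A vector (a_1, ..., a_n) is a function on nat, of which only the values on {1..n} are used.
   The index set of the maximum is nonempty only for n >= 2. *)
definition V :: "nat \<Rightarrow> (nat \<Rightarrow> real) \<Rightarrow> real" where
  "V n a = (MAX k\<in>{1..n-1}. (\<Sum>i=1..k. a i)\<^sup>2) / (\<Sum>i=1..n. (a i)\<^sup>2)"

end

theory Submission
  imports Defs
begin

text \<open>Write \<open>A\<^sub>k = a\<^sub>1 + \<dots> + a\<^sub>k\<close>, \<open>T\<^sub>k = x\<^sub>\<sigma>\<^sub>(\<^sub>1\<^sub>) + \<dots> + x\<^sub>\<sigma>\<^sub>(\<^sub>k\<^sub>)\<close>. For a uniformly random
  permutation, \<open>M\<^sub>k = T\<^sub>k / (n - k)\<close> is a martingale for \<open>k < n\<close>, and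
  summation by parts gives \<open>\<Sum>\<^sub>i\<^sub>\<le>\<^sub>k a\<^sub>i x\<^sub>\<sigma>\<^sub>(\<^sub>i\<^sub>) = N\<^sub>k - A\<^sub>k M\<^sub>k\<close>, where \<open>N\<close> is the martingale
  with increments \<open>((n - j) a\<^sub>j + A\<^sub>j) (M\<^sub>j - M\<^sub>j\<^sub>-\<^sub>1)\<close>. Doob's \<open>L\<^sup>2\<close> maximal inequality bounds
  the maxima of \<open>N\<close> and \<open>M\<close> over \<open>k < n\<close> by their values at \<open>n - 1\<close>. These, as well as the
  remaining term \<open>k = n\<close>, are linear statistics \<open>\<Sum> b\<^sub>i x\<^sub>\<sigma>\<^sub>(\<^sub>i\<^sub>)\<close>, whose second moment is explicit.\<close>

section \<open>Doob's maximal inequality\<close>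

lemma Max_atMost_Suc:
  fixes s :: "nat \<Rightarrow> 'a::linorder"
  shows "(MAX j\<in>{..Suc m}. s j) = max (s (Suc m)) (MAX j\<in>{..m}. s j)"
  by (simp add: atMost_Suc)

text \<open>Discrete integration by parts against the running maximum \<open>S\<close>. In passing
  from \<open>m\<close> to \<open>Suc m\<close> both sides grow equally while \<open>S\<close> stays
  put; when a new maximum is reached, the right side gains the extra amount
  \<open>(s (Suc m) - S)\<^sup>2\<close>.\<close>

lemma pathwise_max_ineq:
  fixes s :: "nat \<Rightarrow> real"
  shows "(MAX j\<in>{..m}. s j)\<^sup>2 + 2 * (\<Sum>i<m. (MAX j\<in>{..i}. s j) * (s (Suc i) - s i))
           \<le> 2 * (MAX j\<in>{..m}. s j) * s m"
proof (induction m)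
  case 0
  then show ?case by (simp add: power2_eq_square)
next
  case (Suc m)
  define S where "S = (MAX j\<in>{..m}. s j)"
  have "(max (s (Suc m)) S)\<^sup>2 - S\<^sup>2 + 2 * (S * (s (Suc m) - s m))
          \<le> 2 * max (s (Suc m)) S * s (Suc m) - 2 * S * s m"
  proof (cases "s (Suc m) \<le> S")
    case True
    then show ?thesis by (simp add: max_def algebra_simps)
  next
    case False
    have "0 \<le> (s (Suc m) - S)\<^sup>2" by simp
    with False show ?thesis by (simp add: max_def power2_eq_square algebra_simps)
  qed
  with Suc.IH show ?case
    by (simp add: Max_atMost_Suc flip: S_def)
qed

text \<open>Doob's inequality in deterministic form: the subtracted sum is a martingale transform
  with a predictable factor, so it averages to zero when \<open>z\<close> is a martingale
  path.\<close>

lemma pathwise_Doob_ineq: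
  fixes z :: "nat \<Rightarrow> real"
  shows "(MAX j\<in>{..m}. \<bar>z j\<bar>)\<^sup>2
           \<le> 4 * (z m)\<^sup>2 - 4 * (\<Sum>i<m. (MAX j\<in>{..i}. \<bar>z j\<bar>) * sgn (z i) * (z (Suc i) - z i))"
proof -
  define S where "S i = (MAX j\<in>{..i}. \<bar>z j\<bar>)" for i
  have nonneg: "0 \<le> S i" for i
  proof -
    have "\<bar>z i\<bar> \<le> S i" unfolding S_def by (intro Max_ge) auto
    then show ?thesis by linarith
  qed
  have "(\<Sum>i<m. S i * sgn (z i) * (z (Suc i) - z i)) \<le> (\<Sum>i<m. S i * (\<bar>z (Suc i)\<bar> - \<bar>z i\<bar>))"
  proof (rule sum_mono)
    fix i
    \<comment> \<open>\<open>sgn (z i)\<close> is a subgradient of the absolute value at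
      \<open>z i\<close>, also when \<open>z i = 0\<close>.\<close>
    have "sgn (z i) * (z (Suc i) - z i) \<le> \<bar>z (Suc i)\<bar> - \<bar>z i\<bar>"
      by (auto simp: sgn_if)
    from mult_left_mono[OF this nonneg[of i]]
    show "S i * sgn (z i) * (z (Suc i) - z i) \<le> S i * (\<bar>z (Suc i)\<bar> - \<bar>z i\<bar>)"
      by (simp add: mult.assoc)
  qed
  moreover have "(S m)\<^sup>2 + 2 * (\<Sum>i<m. S i * (\<bar>z (Suc i)\<bar> - \<bar>z i\<bar>)) \<le> 2 * S m * \<bar>z m\<bar>"
    unfolding S_def by (rule pathwise_max_ineq)
  \<comment> \<open>Doubling the previous bound leaves \<open>2 * (S m)\<^sup>2\<close> on the left;
    this square lets one copy absorb the cross term, which is where the constant 4 comes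
    from.\<close>
  moreover have "0 \<le> (2 * \<bar>z m\<bar> - S m)\<^sup>2" by simp
  then have "4 * S m * \<bar>z m\<bar> \<le> 4 * (z m)\<^sup>2 + (S m)\<^sup>2"
    by (simp add: power2_diff power_mult_distrib mult_ac)
  ultimately show ?thesis
    unfolding S_def[symmetric] by linarith
qed

text \<open>The hypothesis says that \<open>Z\<close> is a martingale with respect to its own filtration under the
  uniform measure on \<open>\<Omega>\<close>.\<close>

lemma Doob_L2:
  fixes Z :: "nat \<Rightarrow> 'a \<Rightarrow> real"
  assumes mart: "\<And>k h. k < m \<Longrightarrow>
      (\<And>\<omega> \<omega>'. \<omega> \<in> \<Omega> \<Longrightarrow> \<omega>' \<in> \<Omega> \<Longrightarrow> (\<And>j. j \<le> k \<Longrightarrow> Z j \<omega> = Z j \<omega>') \<Longrightarrow> h \<omega> = h \<omega>') \<Longrightarrow>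
      (\<Sum>\<omega>\<in>\<Omega>. h \<omega> * (Z (Suc k) \<omega> - Z k \<omega>)) = (0::real)"
  shows "(\<Sum>\<omega>\<in>\<Omega>. (MAX j\<in>{..m}. \<bar>Z j \<omega>\<bar>)\<^sup>2) \<le> 4 * (\<Sum>\<omega>\<in>\<Omega>. (Z m \<omega>)\<^sup>2)"
proof -
  \<comment> \<open>A function of \<open>Z 0\<close>, ..., \<open>Z k\<close> alone, hence an
    admissible test function in \<open>mart\<close>.\<close>
  define h where "h k \<omega> = (MAX j\<in>{..k}. \<bar>Z j \<omega>\<bar>) * sgn (Z k \<omega>)" for k \<omega>
  have "(\<Sum>\<omega>\<in>\<Omega>. (MAX j\<in>{..m}. \<bar>Z j \<omega>\<bar>)\<^sup>2)
      \<le> (\<Sum>\<omega>\<in>\<Omega>. 4 * (Z m \<omega>)\<^sup>2 - 4 * (\<Sum>k<m. h k \<omega> * (Z (Suc k) \<omega> - Z k \<omega>)))"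
    unfolding h_def by (intro sum_mono pathwise_Doob_ineq)
  also have "\<dots> = 4 * (\<Sum>\<omega>\<in>\<Omega>. (Z m \<omega>)\<^sup>2)
      - 4 * (\<Sum>k<m. \<Sum>\<omega>\<in>\<Omega>. h k \<omega> * (Z (Suc k) \<omega> - Z k \<omega>))"
    by (subst sum.swap) (simp add: sum_subtractf flip: sum_distrib_left)
  also have "(\<Sum>k<m. \<Sum>\<omega>\<in>\<Omega>. h k \<omega> * (Z (Suc k) \<omega> - Z k \<omega>)) = 0"
  proof (rule sum.neutral, rule ballI, rule mart)
    fix k \<omega> \<omega>' assume "\<And>j. j \<le> k \<Longrightarrow> Z j \<omega> = Z j \<omega>'"
    then have "(\<lambda>j. \<bar>Z j \<omega>\<bar>) ` {..k} = (\<lambda>j. \<bar>Z j \<omega>'\<bar>) ` {..k}" and "Z k \<omega> = Z k \<omega>'"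
      by (auto intro!: image_cong)
    then show "h k \<omega> = h k \<omega>'" unfolding h_def by simp
  qed auto
  finally show ?thesis by simp
qed

section \<open>Random permutations\<close>

lemma sum_permutes_transpose:
  assumes "i \<in> S" "j \<in> S"
  shows "(\<Sum>\<sigma> | \<sigma> permutes S. f (\<sigma> \<circ> transpose i j)) = (\<Sum>\<sigma> | \<sigma> permutes S. f \<sigma>)"
  using sum_permutations_compose_right[OF permutes_swap_id[OF assms], of f] by simp

lemma sum_permutes_square:
  fixes x :: "'a \<Rightarrow> real"
  assumes "finite S" "i \<in> S"
  shows "card S * (\<Sum>\<sigma> | \<sigma> permutes S. (x (\<sigma> i))\<^sup>2) = fact (card S) * (\<Sum>i\<in>S. (x i)\<^sup>2)"
proof -
  have "card S * (\<Sum>\<sigma> | \<sigma> permutes S. (x (\<sigma> i))\<^sup>2)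
      = (\<Sum>j\<in>S. \<Sum>\<sigma> | \<sigma> permutes S. (x (\<sigma> j))\<^sup>2)"
  proof -
    have "(\<Sum>\<sigma> | \<sigma> permutes S. (x (\<sigma> j))\<^sup>2) = (\<Sum>\<sigma> | \<sigma> permutes S. (x (\<sigma> i))\<^sup>2)" if "j \<in> S" for j
      using sum_permutes_transpose[OF \<open>i \<in> S\<close> that, of "\<lambda>\<sigma>. (x (\<sigma> j))\<^sup>2"] by simp
    then show ?thesis by simp
  qed
  also have "\<dots> = (\<Sum>\<sigma> | \<sigma> permutes S. \<Sum>j\<in>S. (x (\<sigma> j))\<^sup>2)"
    by (rule sum.swap)
  also have "\<dots> = (\<Sum>\<sigma> | \<sigma> permutes S. \<Sum>j\<in>S. (x j)\<^sup>2)"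
    by (rule sum.cong[OF refl]) (simp add: sum.permute[of _ S "\<lambda>j. (x j)\<^sup>2"] o_def)
  also have "\<dots> = fact (card S) * (\<Sum>i\<in>S. (x i)\<^sup>2)"
    using card_permutations[OF refl \<open>finite S\<close>] by simp
  finally show ?thesis .
qed

text \<open>Since the \<open>x (\<sigma> l)\<close> add up to zero, so do their products with
  \<open>x (\<sigma> i)\<close>. By exchangeability the \<open>card S - 1\<close> off-diagonal
  products have the same total.\<close>

lemma sum_permutes_mult:
  fixes x :: "'a \<Rightarrow> real"
  assumes "finite S" "sum x S = 0" "i \<in> S" "j \<in> S" "i \<noteq> j"
  shows "(real (card S) - 1) * (\<Sum>\<sigma> | \<sigma> permutes S. x (\<sigma> i) * x (\<sigma> j))
           = - (\<Sum>\<sigma> | \<sigma> permutes S. (x (\<sigma> i))\<^sup>2)"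
proof -
  let ?Q = "\<lambda>l. \<Sum>\<sigma> | \<sigma> permutes S. x (\<sigma> i) * x (\<sigma> l)"
  have eq: "?Q l = ?Q j" if "l \<in> S - {i}" for l
    using sum_permutes_transpose[of j S l "\<lambda>\<sigma>. x (\<sigma> i) * x (\<sigma> l)"] that assms
    by (simp add: transpose_def split: if_splits)
  have "0 = (\<Sum>\<sigma> | \<sigma> permutes S. x (\<sigma> i) * (\<Sum>l\<in>S. x (\<sigma> l)))"
  proof -
    have "(\<Sum>l\<in>S. x (\<sigma> l)) = 0" if "\<sigma> permutes S" for \<sigma>
      using sum.permute[OF that, of x] assms by (simp add: o_def)
    then show ?thesis by simp
  qed
  also have "\<dots> = (\<Sum>l\<in>S. ?Q l)"
    by (simp add: sum_distrib_left) (rule sum.swap)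
  also have "\<dots> = ?Q i + (\<Sum>l\<in>S - {i}. ?Q l)"
    using assms by (intro sum.remove) auto
  also have "(\<Sum>l\<in>S - {i}. ?Q l) = (real (card S) - 1) * ?Q j"
  proof -
    have "card S \<ge> 1" using assms by (metis One_nat_def Suc_leI card_gt_0_iff empty_iff)
    then show ?thesis
      by (subst sum.cong[OF refl eq]) (use assms in \<open>auto simp: of_nat_diff\<close>)
  qed
  finally show ?thesis by (simp add: power2_eq_square)
qed

lemma sum_permutes_linear_square:
  fixes b x :: "'a \<Rightarrow> real"
  assumes "finite S" "card S \<ge> 2" "sum x S = 0"
  shows "card S * (real (card S) - 1) * (\<Sum>\<sigma> | \<sigma> permutes S. (\<Sum>i\<in>S. b i * x (\<sigma> i))\<^sup>2)
           = fact (card S) * (\<Sum>i\<in>S. (x i)\<^sup>2) * (card S * (\<Sum>i\<in>S. (b i)\<^sup>2) - (sum b S)\<^sup>2)"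
proof -
  let ?n = "real (card S)" and ?F = "fact (card S) * (\<Sum>i\<in>S. (x i)\<^sup>2)"
  let ?Q = "\<lambda>i j. \<Sum>\<sigma> | \<sigma> permutes S. x (\<sigma> i) * x (\<sigma> j)"
  \<comment> \<open>Up to a scalar, the covariance matrix is \<open>?n\<close> times the identity
    minus the all-ones matrix.\<close>
  have Q: "?n * (?n - 1) * ?Q i j = ?F * ((if i = j then ?n else 0) - 1)"
    if "i \<in> S" "j \<in> S" for i j
  proof (cases "i = j")
    case True
    then show ?thesis
      using sum_permutes_square[OF assms(1) that(1), of x]
      by (simp add: power2_eq_square algebra_simps)
  next
    case False
    have "?n * ((?n - 1) * ?Q i j) = ?n * (- (\<Sum>\<sigma> | \<sigma> permutes S. (x (\<sigma> i))\<^sup>2))"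
      by (subst sum_permutes_mult[OF assms(1,3) that False]) simp
    also have "\<dots> = - ?F"
      using sum_permutes_square[OF assms(1) that(1), of x] by simp
    finally show ?thesis using False by (simp add: mult.assoc)
  qed
  have "?n * (?n - 1) * (\<Sum>\<sigma> | \<sigma> permutes S. (\<Sum>i\<in>S. b i * x (\<sigma> i))\<^sup>2)
      = ?n * (?n - 1) * (\<Sum>\<sigma> | \<sigma> permutes S. \<Sum>i\<in>S. \<Sum>j\<in>S. b i * b j * (x (\<sigma> i) * x (\<sigma> j)))"
    by (simp add: power2_eq_square sum_product mult_ac)
  also have "\<dots> = ?n * (?n - 1) * (\<Sum>i\<in>S. \<Sum>j\<in>S. b i * b j * ?Q i j)"
    by (subst sum.swap, subst sum.swap) (simp add: sum_distrib_left)
  also have "\<dots> = (\<Sum>i\<in>S. \<Sum>j\<in>S. b i * b j * (?n * (?n - 1) * ?Q i j))"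
    by (simp only: sum_distrib_left mult_ac)
  also have "\<dots> = (\<Sum>i\<in>S. \<Sum>j\<in>S. b i * b j * (?F * ((if i = j then ?n else 0) - 1)))"
    by (intro sum.cong refl) (simp only: Q)
  also have "\<dots> = ?F * (\<Sum>i\<in>S. \<Sum>j\<in>S. (if i = j then ?n * (b i * b j) else 0) - b i * b j)"
    unfolding sum_distrib_left by (intro sum.cong refl) (simp add: algebra_simps)
  also have "(\<Sum>i\<in>S. \<Sum>j\<in>S. (if i = j then ?n * (b i * b j) else 0) - b i * b j)
      = ?n * (\<Sum>i\<in>S. (b i)\<^sup>2) - (sum b S)\<^sup>2"
    using assms(1)
    by (simp add: sum_subtractf power2_eq_square sum_product flip: sum_distrib_left)
  finally show ?thesis .
qed

section \<open>The martingales\<close>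

text \<open>Given the first \<open>j\<close> values, \<open>x\<^sub>\<sigma>\<^sub>(\<^sub>j\<^sub>+\<^sub>1\<^sub>)\<close> has mean \<open>- T\<^sub>j / (n - j)\<close>, so the summands below are
  martingale differences.\<close>

definition perm_mart :: "nat \<Rightarrow> (nat \<Rightarrow> real) \<Rightarrow> (nat \<Rightarrow> real) \<Rightarrow> nat \<Rightarrow> (nat \<Rightarrow> nat) \<Rightarrow> real" where
  "perm_mart n x c k \<sigma> =
     (\<Sum>j<k. c j * (x (\<sigma> (Suc j)) + (\<Sum>i=1..j. x (\<sigma> i)) / (real n - real j)))"

text \<open>\<open>inv\<close> expresses that \<open>h\<close> cannot tell position
  \<open>Suc k\<close> from any later one. All these positions then have the same
  \<open>h\<close>-weighted total, and the zero sum of \<open>x\<close> fixes what they add up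
  to.\<close>

lemma perm_mart_diff_orthogonal:
  fixes x :: "nat \<Rightarrow> real"
  assumes "k < n" "sum x {1..n} = 0"
    and inv: "\<And>\<sigma> i. \<sigma> permutes {1..n} \<Longrightarrow> i \<in> {Suc k..n} \<Longrightarrow> h (\<sigma> \<circ> transpose (Suc k) i) = h \<sigma>"
  shows "(\<Sum>\<sigma> | \<sigma> permutes {1..n}.
            h \<sigma> * (x (\<sigma> (Suc k)) + (\<Sum>i=1..k. x (\<sigma> i)) / (real n - real k))) = 0"
proof -
  let ?P = "{\<sigma>. \<sigma> permutes {1..n}}"
  let ?r = "\<Sum>\<sigma>\<in>?P. h \<sigma> * x (\<sigma> (Suc k))"
  have eq: "(\<Sum>\<sigma>\<in>?P. h \<sigma> * x (\<sigma> i)) = ?r" if "i \<in> {Suc k..n}" for i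
  proof -
    have "(\<Sum>\<sigma>\<in>?P. h \<sigma> * x (\<sigma> i))
        = (\<Sum>\<sigma>\<in>?P. h (\<sigma> \<circ> transpose (Suc k) i) * x ((\<sigma> \<circ> transpose (Suc k) i) i))"
      using that assms(1)
      by (intro sum_permutes_transpose[of "Suc k" "{1..n}" i, symmetric]) auto
    also have "\<dots> = ?r"
      using inv[OF _ that] by simp
    finally show ?thesis .
  qed
  have "(real n - real k) * ?r = (\<Sum>i\<in>{Suc k..n}. \<Sum>\<sigma>\<in>?P. h \<sigma> * x (\<sigma> i))"
    using assms(1) by (subst sum.cong[OF refl eq]) (auto simp: of_nat_diff)
  also have "\<dots> = (\<Sum>\<sigma>\<in>?P. h \<sigma> * (\<Sum>i\<in>{Suc k..n}. x (\<sigma> i)))"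
    by (subst sum.swap) (simp add: sum_distrib_left)
  also have "\<dots> = (\<Sum>\<sigma>\<in>?P. - (h \<sigma> * (\<Sum>i=1..k. x (\<sigma> i))))"
  proof (intro sum.cong refl)
    fix \<sigma> assume "\<sigma> \<in> ?P"
    then have "(\<Sum>i=1..n. x (\<sigma> i)) = 0"
      using sum.permute[of \<sigma> "{1..n}" x] assms(2) by (simp add: o_def)
    moreover have "(\<Sum>i=1..n. x (\<sigma> i)) = (\<Sum>i=1..k. x (\<sigma> i)) + (\<Sum>i\<in>{Suc k..n}. x (\<sigma> i))"
      using assms(1) sum.ub_add_nat[of 1 k "\<lambda>i. x (\<sigma> i)" "n - k"] by simp
    ultimately have "(\<Sum>i\<in>{Suc k..n}. x (\<sigma> i)) = - (\<Sum>i=1..k. x (\<sigma> i))" by linarith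
    then show "h \<sigma> * (\<Sum>i\<in>{Suc k..n}. x (\<sigma> i)) = - (h \<sigma> * (\<Sum>i=1..k. x (\<sigma> i)))" by simp
  qed
  finally have "?r + (\<Sum>\<sigma>\<in>?P. h \<sigma> * (\<Sum>i=1..k. x (\<sigma> i))) / (real n - real k) = 0"
    using assms(1) by (simp add: sum_negf field_simps)
  then show ?thesis
    by (simp add: distrib_left sum.distrib flip: sum_divide_distrib)
qed

text \<open>The first \<open>k\<close> martingale values read \<sigma> only at positions up to
  \<open>k\<close>. A function of them is therefore invariant under swapping position
  \<open>Suc k\<close> with a later one, as orthogonality requires.\<close>

lemma perm_mart_maximal:
  fixes x :: "nat \<Rightarrow> real"
  assumes "m \<le> n" "sum x {1..n} = 0"
  shows "(\<Sum>\<sigma> | \<sigma> permutes {1..n}. (MAX j\<in>{..m}. \<bar>perm_mart n x c j \<sigma>\<bar>)\<^sup>2)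
           \<le> 4 * (\<Sum>\<sigma> | \<sigma> permutes {1..n}. (perm_mart n x c m \<sigma>)\<^sup>2)"
proof (rule Doob_L2)
  fix k and h :: "(nat \<Rightarrow> nat) \<Rightarrow> real"
  assume k: "k < m"
    and h: "\<And>\<sigma> \<sigma>'. \<sigma> \<in> {\<sigma>. \<sigma> permutes {1..n}} \<Longrightarrow> \<sigma>' \<in> {\<sigma>. \<sigma> permutes {1..n}} \<Longrightarrow>
      (\<And>j. j \<le> k \<Longrightarrow> perm_mart n x c j \<sigma> = perm_mart n x c j \<sigma>') \<Longrightarrow> h \<sigma> = h \<sigma>'"
  have "(\<Sum>\<sigma> | \<sigma> permutes {1..n}. c k * h \<sigma> *
           (x (\<sigma> (Suc k)) + (\<Sum>i=1..k. x (\<sigma> i)) / (real n - real k))) = 0"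
  proof (rule perm_mart_diff_orthogonal[OF _ assms(2)])
    fix \<sigma> i assume \<sigma>: "\<sigma> permutes {1..n}" and i: "i \<in> {Suc k..n}"
    have fix_le: "(\<sigma> \<circ> transpose (Suc k) i) l = \<sigma> l" if "l \<le> k" for l
      using that i by (simp add: transpose_def)
    have "\<sigma> \<circ> transpose (Suc k) i permutes {1..n}"
      using \<sigma> i by (intro permutes_compose permutes_swap_id) auto
    moreover have "perm_mart n x c j (\<sigma> \<circ> transpose (Suc k) i) = perm_mart n x c j \<sigma>"
      if "j \<le> k" for j
      unfolding perm_mart_def using that
      by (intro sum.cong refl arg_cong2[of _ _ _ _ "(*)"] arg_cong2[of _ _ _ _ "(+)"]
          arg_cong2[of _ _ _ _ "(/)"] arg_cong[of _ _ x] fix_le) auto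
    ultimately have "h (\<sigma> \<circ> transpose (Suc k) i) = h \<sigma>"
      using \<sigma> by (intro h) auto
    then show "c k * h (\<sigma> \<circ> transpose (Suc k) i) = c k * h \<sigma>" by simp
  qed (use k assms(1) in simp)
  then show "(\<Sum>\<sigma> | \<sigma> permutes {1..n}. h \<sigma> * (perm_mart n x c (Suc k) \<sigma> - perm_mart n x c k \<sigma>)) = 0"
    by (simp add: perm_mart_def mult_ac)
qed

text \<open>Identifies the martingale \<open>M\<close> of the introduction: its increment is the
  centred draw divided by the number of positions left after it.\<close>

lemma perm_mart_average:
  assumes "k < n"
  shows "perm_mart n x (\<lambda>j. 1 / (real n - real (Suc j))) k \<sigma>
           = (\<Sum>i=1..k. x (\<sigma> i)) / (real n - real k)"
  using assms
proof (induction k)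
  case 0
  then show ?case by (simp add: perm_mart_def)
next
  case (Suc k)
  have "real n - real k > 0" "real n - real (Suc k) > 0" using Suc.prems by linarith+
  then have "y / (real n - real k) + 1 / (real n - real (Suc k)) * (u + y / (real n - real k))
      = (y + u) / (real n - real (Suc k))" for y u
    by (simp add: divide_simps) (simp add: algebra_simps)
  with Suc show ?case by (simp add: perm_mart_def)
qed

text \<open>The summation by parts. Weight \<open>j\<close> belongs to the draw at position
  \<open>Suc j\<close>; dividing \<open>(n - i) * a i + A i\<close> at \<open>i = Suc j\<close> by
  \<open>n - i\<close> gives the coefficient used here, as the summands of \<open>perm_mart\<close>
  are \<open>n - i\<close> times the increments of \<open>M\<close>.\<close>

lemma weighted_sum_eq_perm_mart:
  assumes "k < n"
  shows "(\<Sum>i=1..k. a i * x (\<sigma> i))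
       = perm_mart n x (\<lambda>j. a (Suc j) + (\<Sum>i=1..Suc j. a i) / (real n - real (Suc j))) k \<sigma>
         - (\<Sum>i=1..k. a i) * perm_mart n x (\<lambda>j. 1 / (real n - real (Suc j))) k \<sigma>"
  using assms
proof (induction k)
  case 0
  then show ?case by (simp add: perm_mart_def)
next
  case (Suc k)
  let ?c = "\<lambda>j. a (Suc j) + (\<Sum>i=1..Suc j. a i) / (real n - real (Suc j))"
  let ?d = "\<lambda>j. 1 / (real n - real (Suc j))"
  define A where "A = (\<Sum>i=1..k. a i)"
  define M where "M = perm_mart n x ?d k \<sigma>"
  define D where "D = x (\<sigma> (Suc k)) + M"
  have M: "M = (\<Sum>i=1..k. x (\<sigma> i)) / (real n - real k)"
    unfolding M_def using Suc.prems by (intro perm_mart_average) simp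
  have N': "perm_mart n x ?c (Suc k) \<sigma>
      = perm_mart n x ?c k \<sigma> + (a (Suc k) + (A + a (Suc k)) * ?d k) * D"
    by (simp add: perm_mart_def D_def M A_def)
  have M': "perm_mart n x ?d (Suc k) \<sigma> = M + ?d k * D"
    unfolding D_def by (subst (2) M) (simp add: perm_mart_def M_def)
  have IH: "(\<Sum>i=1..k. a i * x (\<sigma> i)) = perm_mart n x ?c k \<sigma> - A * M"
    using Suc unfolding A_def M_def by simp
  have A': "(\<Sum>i=1..Suc k. a i) = A + a (Suc k)" by (simp add: A_def)
  have "(\<Sum>i=1..Suc k. a i * x (\<sigma> i))
      = perm_mart n x ?c k \<sigma> - A * M + a (Suc k) * x (\<sigma> (Suc k))"
    using IH by simp
  \<comment> \<open>Substitute \<open>x (\<sigma> (Suc k)) = D - M\<close>, then add and subtract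
    \<open>(A + a (Suc k)) * ?d k * D\<close>.\<close>
  also have "\<dots> = perm_mart n x ?c k \<sigma> + (a (Suc k) + (A + a (Suc k)) * ?d k) * D
      - (A + a (Suc k)) * (M + ?d k * D)"
    unfolding D_def by (simp add: algebra_simps del: of_nat_Suc)
  finally show ?case unfolding N' M' A' .
qed

section \<open>The maximal inequality for weighted sums\<close>

theorem proposition8:
  fixes n :: nat and a x :: "nat \<Rightarrow> real"
  assumes "n \<ge> 2"
    and "\<exists>i\<in>{1..n}. a i \<noteq> 0"
    and "(\<Sum>i=1..n. x i) = 0"
  shows "(1 / fact n) *
           (\<Sum>\<sigma> | \<sigma> permutes {1..n}. MAX k\<in>{1..n}. \<bar>\<Sum>i=1..k. a i * x (\<sigma> i)\<bar>\<^sup>2)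
         \<le> (16 / (real n - 1)) * (1 + 2 * V n a) * (\<Sum>i=1..n. (a i)\<^sup>2) * (\<Sum>i=1..n. (x i)\<^sup>2)"
proof -
  let ?P = "{\<sigma>. \<sigma> permutes {1..n}}"
  define A where "A k = (\<Sum>i=1..k. a i)" for k
  define S where "S k \<sigma> = (\<Sum>i=1..k. a i * x (\<sigma> i))" for k and \<sigma> :: "nat \<Rightarrow> nat"
  define M where "M = perm_mart n x (\<lambda>j. 1 / (real n - real (Suc j)))"
  define N where
    "N = perm_mart n x (\<lambda>j. a (Suc j) + (\<Sum>i=1..Suc j. a i) / (real n - real (Suc j)))"
  define \<alpha> where "\<alpha> = (MAX k\<in>{1..n-1}. (A k)\<^sup>2)"
  define a2 where "a2 = (\<Sum>i=1..n. (a i)\<^sup>2)"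
  \<comment> \<open>The common scale of all the second moments below, summed rather than averaged
    over \<sigma>.\<close>
  define K where "K = fact n * (\<Sum>i=1..n. (x i)\<^sup>2) / (real n - 1)"
  have n1: "real n - 1 > 0" using assms(1) by simp
  have ivl: "{1..n} = insert n {1..n-1}" "n \<notin> {1..n-1}" using assms(1) by auto
  have K0: "K \<ge> 0" unfolding K_def using n1 by (simp add: sum_nonneg)
  have a2_pos: "a2 > 0"
    unfolding a2_def using assms(2) by (auto intro: sum_pos2)
  have A_le: "(A k)\<^sup>2 \<le> \<alpha>" if "k \<in> {1..n-1}" for k
    unfolding \<alpha>_def using that by (intro Max_ge) auto
  have \<alpha>0: "\<alpha> \<ge> 0" using A_le[of 1] assms(1) by (force intro: order_trans[OF zero_le_power2])
  have V: "V n a * a2 = \<alpha>"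
    using a2_pos by (simp add: V_def \<alpha>_def A_def a2_def)
  have moment: "(\<Sum>\<sigma>\<in>?P. (\<Sum>i=1..n. b i * x (\<sigma> i))\<^sup>2)
      = K * ((\<Sum>i=1..n. (b i)\<^sup>2) - (sum b {1..n})\<^sup>2 / n)" for b
  proof -
    have "real n * (real n - 1) * (\<Sum>\<sigma>\<in>?P. (\<Sum>i=1..n. b i * x (\<sigma> i))\<^sup>2)
      = fact n * (\<Sum>i=1..n. (x i)\<^sup>2) * (n * (\<Sum>i=1..n. (b i)\<^sup>2) - (sum b {1..n})\<^sup>2)"
      using sum_permutes_linear_square[of "{1..n}" x b] assms(1,3) by simp
    then show ?thesis unfolding K_def using n1 by (simp add: field_simps)
  qed
  have S_eq: "S k \<sigma> = N k \<sigma> - A k * M k \<sigma>" if "k \<le> n - 1" for k \<sigma>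
    unfolding S_def N_def A_def M_def
    using that assms(1) by (intro weighted_sum_eq_perm_mart) simp
  \<comment> \<open>At time \<open>n-1\<close> the denominator is 1, and the zero total turns the
    partial sum into the one missing value.\<close>
  have M_last: "M (n-1) \<sigma> = - x (\<sigma> n)" if "\<sigma> \<in> ?P" for \<sigma>
  proof -
    have "(\<Sum>i=1..n. x (\<sigma> i)) = 0"
      using sum.permute[of \<sigma> "{1..n}" x] assms(3) that by (simp add: o_def)
    then have "(\<Sum>i=1..n-1. x (\<sigma> i)) = - x (\<sigma> n)" using ivl by simp
    then show ?thesis
      unfolding M_def using assms(1) by (subst perm_mart_average) (auto simp: of_nat_diff)
  qed
  have sum_M: "(\<Sum>\<sigma>\<in>?P. (M (n-1) \<sigma>)\<^sup>2) \<le> K"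
  proof -
    have "(\<Sum>\<sigma>\<in>?P. (M (n-1) \<sigma>)\<^sup>2) = (\<Sum>\<sigma>\<in>?P. (x (\<sigma> n))\<^sup>2)"
      by (intro sum.cong refl) (simp only: M_last power2_minus)
    also have "\<dots> = fact n * (\<Sum>i=1..n. (x i)\<^sup>2) / n"
      using sum_permutes_square[of "{1..n}" n x] assms(1) by (simp add: field_simps)
    also have "\<dots> \<le> K"
      unfolding K_def using n1 by (intro divide_left_mono) (auto simp: sum_nonneg)
    finally show ?thesis .
  qed
  have sum_N: "(\<Sum>\<sigma>\<in>?P. (N (n-1) \<sigma>)\<^sup>2) \<le> K * (a2 + \<alpha>)"
  proof -
    \<comment> \<open>\<open>S_eq\<close> and \<open>M_last\<close> give \<open>N (n-1) \<sigma> = S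
      (n-1) \<sigma> - A (n-1) * x (\<sigma> n)\<close>, a linear statistic with last coefficient
      \<open>- A (n-1)\<close>.\<close>
    define b where "b = a(n := - A (n-1))"
    have b: "b n = - A (n-1)" "\<And>i. i \<in> {1..n-1} \<Longrightarrow> b i = a i"
      using ivl(2) unfolding b_def by (simp, metis fun_upd_other)
    have "N (n-1) \<sigma> = (\<Sum>i=1..n. b i * x (\<sigma> i))" if "\<sigma> \<in> ?P" for \<sigma>
    proof -
      have "(\<Sum>i=1..n. b i * x (\<sigma> i)) = S (n-1) \<sigma> - A (n-1) * x (\<sigma> n)"
        unfolding ivl(1) S_def using ivl(2) b by simp
      then show ?thesis using S_eq[of "n-1" \<sigma>] M_last[OF that] by simp
    qed
    then have "(\<Sum>\<sigma>\<in>?P. (N (n-1) \<sigma>)\<^sup>2) = (\<Sum>\<sigma>\<in>?P. (\<Sum>i=1..n. b i * x (\<sigma> i))\<^sup>2)"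
      by simp
    also have "\<dots> \<le> K * (\<Sum>i=1..n. (b i)\<^sup>2)"
      unfolding moment using K0 by (intro mult_left_mono) auto
    also have "(\<Sum>i=1..n. (b i)\<^sup>2) = (\<Sum>i=1..n-1. (a i)\<^sup>2) + (A (n-1))\<^sup>2"
      unfolding ivl(1) using ivl(2) b by simp
    also have "\<dots> \<le> a2 + \<alpha>"
    proof (rule add_mono)
      show "(\<Sum>i=1..n-1. (a i)\<^sup>2) \<le> a2" unfolding a2_def by (intro sum_mono2) auto
      show "(A (n-1))\<^sup>2 \<le> \<alpha>" using assms(1) by (intro A_le) auto
    qed
    finally show ?thesis using K0 by (simp add: mult_left_mono)
  qed
  have sum_S: "(\<Sum>\<sigma>\<in>?P. (S n \<sigma>)\<^sup>2) \<le> K * a2"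
    unfolding S_def moment a2_def using K0 by (intro mult_left_mono) auto
  define MM where "MM \<sigma> = (MAX j\<in>{..n-1}. \<bar>M j \<sigma>\<bar>)" for \<sigma>
  define NM where "NM \<sigma> = (MAX j\<in>{..n-1}. \<bar>N j \<sigma>\<bar>)" for \<sigma>
  \<comment> \<open>For \<open>k < n\<close> this is
    \<open>(u - v)\<^sup>2 \<le> 2 * u\<^sup>2 + 2 * v\<^sup>2\<close> applied to
    \<open>S_eq\<close>. The index \<open>k = n\<close>, where the denominator of \<open>M\<close>
    would vanish, is covered by the separate last term.\<close>
  have path: "(MAX k\<in>{1..n}. \<bar>S k \<sigma>\<bar>\<^sup>2) \<le> 2 * (NM \<sigma>)\<^sup>2 + 2 * \<alpha> * (MM \<sigma>)\<^sup>2 + (S n \<sigma>)\<^sup>2" for \<sigma>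
  proof (rule Max.boundedI)
    fix y assume "y \<in> (\<lambda>k. \<bar>S k \<sigma>\<bar>\<^sup>2) ` {1..n}"
    then obtain k where k: "k \<in> {1..n}" "y = (S k \<sigma>)\<^sup>2" by auto
    show "y \<le> 2 * (NM \<sigma>)\<^sup>2 + 2 * \<alpha> * (MM \<sigma>)\<^sup>2 + (S n \<sigma>)\<^sup>2"
    proof (cases "k = n")
      case True
      then show ?thesis using k \<alpha>0 by simp
    next
      case False
      then have k': "k \<in> {1..n-1}" using k by auto
      have "(N k \<sigma>)\<^sup>2 \<le> (NM \<sigma>)\<^sup>2"
        unfolding NM_def by (rule power2_le_iff_abs_le[THEN iffD2])
          (use k' in \<open>auto intro!: Max_ge order_trans[OF abs_ge_zero Max_ge]\<close>)
      moreover have "(M k \<sigma>)\<^sup>2 \<le> (MM \<sigma>)\<^sup>2"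
        unfolding MM_def by (rule power2_le_iff_abs_le[THEN iffD2])
          (use k' in \<open>auto intro!: Max_ge order_trans[OF abs_ge_zero Max_ge]\<close>)
      then have "(A k)\<^sup>2 * (M k \<sigma>)\<^sup>2 \<le> \<alpha> * (MM \<sigma>)\<^sup>2"
        using A_le[OF k'] \<alpha>0 by (intro mult_mono) auto
      moreover have "(S k \<sigma>)\<^sup>2 \<le> 2 * (N k \<sigma>)\<^sup>2 + 2 * ((A k)\<^sup>2 * (M k \<sigma>)\<^sup>2)"
      proof -
        have "0 \<le> (N k \<sigma> + A k * M k \<sigma>)\<^sup>2" by simp
        moreover have "S k \<sigma> = N k \<sigma> - A k * M k \<sigma>"
          using k' by (intro S_eq) simp
        ultimately show ?thesis
          by (simp only:) (simp add: power2_eq_square algebra_simps)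
      qed
      ultimately show ?thesis using k(2) zero_le_power2[of "S n \<sigma>"] by linarith
    qed
  qed (use assms(1) in auto)
  have "(\<Sum>\<sigma>\<in>?P. MAX k\<in>{1..n}. \<bar>S k \<sigma>\<bar>\<^sup>2)
      \<le> (\<Sum>\<sigma>\<in>?P. 2 * (NM \<sigma>)\<^sup>2 + 2 * \<alpha> * (MM \<sigma>)\<^sup>2 + (S n \<sigma>)\<^sup>2)"
    by (intro sum_mono path)
  also have "\<dots> = 2 * (\<Sum>\<sigma>\<in>?P. (NM \<sigma>)\<^sup>2) + 2 * \<alpha> * (\<Sum>\<sigma>\<in>?P. (MM \<sigma>)\<^sup>2) + (\<Sum>\<sigma>\<in>?P. (S n \<sigma>)\<^sup>2)"
    by (simp add: sum.distrib sum_distrib_left)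
  \<comment> \<open>Each inner factor 4 is Doob's constant; the endpoint term \<open>K * a2\<close>
    needs no maximal inequality.\<close>
  also have "\<dots> \<le> 2 * (4 * (K * (a2 + \<alpha>))) + 2 * \<alpha> * (4 * K) + K * a2"
  proof (intro add_mono mult_left_mono sum_S)
    have "(\<Sum>\<sigma>\<in>?P. (NM \<sigma>)\<^sup>2) \<le> 4 * (\<Sum>\<sigma>\<in>?P. (N (n-1) \<sigma>)\<^sup>2)"
      unfolding NM_def N_def using assms(3) by (intro perm_mart_maximal) auto
    with sum_N show "(\<Sum>\<sigma>\<in>?P. (NM \<sigma>)\<^sup>2) \<le> 4 * (K * (a2 + \<alpha>))" by linarith
    have "(\<Sum>\<sigma>\<in>?P. (MM \<sigma>)\<^sup>2) \<le> 4 * (\<Sum>\<sigma>\<in>?P. (M (n-1) \<sigma>)\<^sup>2)"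
      unfolding MM_def M_def using assms(3) by (intro perm_mart_maximal) auto
    with sum_M show "(\<Sum>\<sigma>\<in>?P. (MM \<sigma>)\<^sup>2) \<le> 4 * K" by linarith
  qed (use \<alpha>0 in auto)
  also have "\<dots> = K * (9 * a2 + 16 * \<alpha>)" by (simp add: algebra_simps)
  \<comment> \<open>The constants are relaxed to the stated form; \<open>V\<close> then returns
    through \<open>V n a * a2 = \<alpha>\<close>.\<close>
  also have "\<dots> \<le> K * (16 * (a2 + 2 * \<alpha>))"
    using K0 \<alpha>0 a2_pos by (intro mult_left_mono) auto
  finally have "(1 / fact n) * (\<Sum>\<sigma>\<in>?P. MAX k\<in>{1..n}. \<bar>S k \<sigma>\<bar>\<^sup>2)
      \<le> (1 / fact n) * (K * (16 * (a2 + 2 * \<alpha>)))"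
    by (intro mult_left_mono) auto
  also have "\<dots> = (16 / (real n - 1)) * (1 + 2 * V n a) * a2 * (\<Sum>i=1..n. (x i)\<^sup>2)"
    unfolding K_def V[symmetric] by (simp add: algebra_simps add_divide_distrib)
  finally show ?thesis unfolding S_def a2_def .
qed

end
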